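(* Any commutative post-Lie algebra structure on the generalized loop Heisenberg-Virasoro algebra $\mathcal{L}(\Gamma)$ is trivial, i.e. its product satisfies $x\cdot y=0$ for all $x,y\in\mathcal{L}(\Gamma)$.
   Context: $\mathbb{F}$ is an algebraically closed field of characteristic zero; all vector spaces and algebras are over $\mathbb{F}$. $\Gamma$ is an additive subgroup of $\mathbb{F}$. The generalized loop Heisenberg-Virasoro algebra $\mathcal{L}(\Gamma)$ is the Lie algebra over $\mathbb{F}$ with basis $\{L_{\alpha,i},H_{\beta,j}\mid \alpha,\beta\in\Gamma,\ i,j\in\mathbb{Z}\}$ and brackets $[L_{\alpha,i},L_{\beta,j}]=(\alpha-\beta)L_{\alpha+\beta,i+j}$, $[L_{\alpha,i},H_{\beta,j}]=-\beta H_{\alpha+\beta,i+j}$, $[H_{\alpha,i},H_{\beta,j}]=0$. A commutative post-Lie algebra structure on a Lie algebra $(L,[\,,])$ is a bilinear product $x\cdot y$ on $L$ such that for all $x,y,z\in L$: $x\cdot y=y\cdot x$; $[x,y]\cdot z=x\cdot(y\cdot z)-y\cdot(x\cdot z)$; $x\cdot[y,z]=[x\cdot y,z]+[y,x\cdot z]$.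
   Formalization: The subgroup Γ is assumed nonzero: for Γ = {0} the algebra is abelian and the product with L_{0,0}·L_{0,0} = H_{0,0}, all other basis products zero, is a nontrivial commutative post-Lie structure, so the claim fails there. *)

theory Defs
  imports
    "HOL-Library.Poly_Mapping"
    "HOL-Computational_Algebra.Polynomial"
begin

definition bilinear_product_on ::
    "('k::field \<Rightarrow> 'v::ab_group_add \<Rightarrow> 'v) \<Rightarrow> 'v set \<Rightarrow> ('v \<Rightarrow> 'v \<Rightarrow> 'v) \<Rightarrow> bool" where
  "bilinear_product_on scale V f \<longleftrightarrow>
     (\<forall>x\<in>V. \<forall>y\<in>V. f x y \<in> V) \<and>
     (\<forall>x\<in>V. \<forall>y\<in>V. \<forall>z\<in>V. f (x + y) z = f x z + f y z) \<and>
     (\<forall>x\<in>V. \<forall>y\<in>V. \<forall>z\<in>V. f x (y + z) = f x y + f x z) \<and>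
     (\<forall>c. \<forall>x\<in>V. \<forall>y\<in>V. f (scale c x) y = scale c (f x y)) \<and>
     (\<forall>c. \<forall>x\<in>V. \<forall>y\<in>V. f x (scale c y) = scale c (f x y))"

text \<open>Lie algebras live on a subspace \<open>V\<close> of an ambient vector space; operations are only
  constrained on \<open>V\<close>.\<close>

locale lie_algebra = vector_space scale
  for scale :: "'k::field \<Rightarrow> 'v::ab_group_add \<Rightarrow> 'v" +
  fixes V :: "'v set" and bracket :: "'v \<Rightarrow> 'v \<Rightarrow> 'v"
  assumes subspace_carrier: "subspace V"
    and bilinear_bracket: "bilinear_product_on scale V bracket"
    and bracket_self: "x \<in> V \<Longrightarrow> bracket x x = 0"
    and jacobi: "x \<in> V \<Longrightarrow> y \<in> V \<Longrightarrow> z \<in> V \<Longrightarrow>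
      bracket x (bracket y z) + bracket y (bracket z x) + bracket z (bracket x y) = 0"

locale commutative_post_lie = lie_algebra scale V bracket
  for scale :: "'k::field \<Rightarrow> 'v::ab_group_add \<Rightarrow> 'v" and V bracket +
  fixes mul :: "'v \<Rightarrow> 'v \<Rightarrow> 'v"
  assumes bilinear_prod: "bilinear_product_on scale V mul"
    and prod_commute: "x \<in> V \<Longrightarrow> y \<in> V \<Longrightarrow> mul x y = mul y x"
    and bracket_prod: "x \<in> V \<Longrightarrow> y \<in> V \<Longrightarrow> z \<in> V \<Longrightarrow>
      mul (bracket x y) z = mul x (mul y z) - mul y (mul x z)"
    and prod_bracket: "x \<in> V \<Longrightarrow> y \<in> V \<Longrightarrow> z \<in> V \<Longrightarrow>
      mul x (bracket y z) = bracket (mul x y) z + bracket y (mul x z)"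

datatype 'k hv_index = L 'k int | H 'k int

type_synonym 'k hv = "'k hv_index \<Rightarrow>\<^sub>0 'k"

definition hv_scale :: "'k::field \<Rightarrow> 'k hv \<Rightarrow> 'k hv" where
  "hv_scale c = Poly_Mapping.map ((*) c)"

definition hv_carrier :: "'k::field set \<Rightarrow> 'k hv set" where
  "hv_carrier \<Gamma> = {x. Poly_Mapping.keys x \<subseteq> {L \<alpha> i |\<alpha> i. \<alpha> \<in> \<Gamma>} \<union> {H \<alpha> i |\<alpha> i. \<alpha> \<in> \<Gamma>}}"

text \<open>Each \<open>single p 1\<close> is the basis vector indexed by \<open>p\<close>. The third equation is the second one
  read through antisymmetry.\<close>

fun hv_basis_bracket :: "'k::field hv_index \<Rightarrow> 'k hv_index \<Rightarrow> 'k hv" where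
  "hv_basis_bracket (L \<alpha> i) (L \<beta> j) = Poly_Mapping.single (L (\<alpha> + \<beta>) (i + j)) (\<alpha> - \<beta>)"
| "hv_basis_bracket (L \<alpha> i) (H \<beta> j) = Poly_Mapping.single (H (\<alpha> + \<beta>) (i + j)) (- \<beta>)"
| "hv_basis_bracket (H \<alpha> i) (L \<beta> j) = Poly_Mapping.single (H (\<alpha> + \<beta>) (i + j)) \<alpha>"
| "hv_basis_bracket (H \<alpha> i) (H \<beta> j) = 0"

definition hv_bracket :: "'k::field hv \<Rightarrow> 'k hv \<Rightarrow> 'k hv" where
  "hv_bracket x y = (\<Sum>p\<in>Poly_Mapping.keys x. \<Sum>q\<in>Poly_Mapping.keys y.
     hv_scale (Poly_Mapping.lookup x p * Poly_Mapping.lookup y q) (hv_basis_bracket p q))"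

lemma lookup_hv_scale [simp]: "Poly_Mapping.lookup (hv_scale c x) p = c * Poly_Mapping.lookup x p"
  unfolding hv_scale_def by transfer (simp add: when_def)

lemma vector_space_hv_scale: "vector_space hv_scale"
  by unfold_locales (auto intro!: poly_mapping_eqI simp: lookup_add algebra_simps)

interpretation hv: vector_space hv_scale
  by (rule vector_space_hv_scale)

lemma subspace_hv_carrier: "hv.subspace (hv_carrier \<Gamma>)"
proof (rule hv.subspaceI)
  show "0 \<in> hv_carrier \<Gamma>" by (simp add: hv_carrier_def)
next
  fix x y assume "x \<in> hv_carrier \<Gamma>" "y \<in> hv_carrier \<Gamma>"
  then show "x + y \<in> hv_carrier \<Gamma>"
    using Poly_Mapping.keys_add[of x y] unfolding hv_carrier_def by blast
next
  fix c x assume "x \<in> hv_carrier \<Gamma>"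
  moreover have "Poly_Mapping.keys (hv_scale c x) \<subseteq> Poly_Mapping.keys x" by (auto simp: in_keys_iff)
  ultimately show "hv_scale c x \<in> hv_carrier \<Gamma>" unfolding hv_carrier_def by blast
qed

lemma hv_bracket_eq_sum:
  assumes "finite A" "finite B" "Poly_Mapping.keys x \<subseteq> A" "Poly_Mapping.keys y \<subseteq> B"
  shows "hv_bracket x y = (\<Sum>p\<in>A. \<Sum>q\<in>B. hv_scale (Poly_Mapping.lookup x p * Poly_Mapping.lookup y q) (hv_basis_bracket p q))"
proof -
  have "hv_bracket x y = (\<Sum>p\<in>Poly_Mapping.keys x. \<Sum>q\<in>B. hv_scale (Poly_Mapping.lookup x p * Poly_Mapping.lookup y q) (hv_basis_bracket p q))"
    unfolding hv_bracket_def
    using assms by (intro sum.cong refl sum.mono_neutral_left) (auto simp: in_keys_iff)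
  also have "\<dots> = (\<Sum>p\<in>A. \<Sum>q\<in>B. hv_scale (Poly_Mapping.lookup x p * Poly_Mapping.lookup y q) (hv_basis_bracket p q))"
    using assms by (intro sum.mono_neutral_left) (auto simp: in_keys_iff)
  finally show ?thesis .
qed

lemma hv_bracket_single:
  "hv_bracket (Poly_Mapping.single p a) (Poly_Mapping.single q b) = hv_scale (a * b) (hv_basis_bracket p q)"
  by (subst hv_bracket_eq_sum[of "{p}" "{q}"]) (auto simp: lookup_single)

lemma hv_bracket_add_left: "hv_bracket (x + y) z = hv_bracket x z + hv_bracket y z"
proof -
  let ?A = "Poly_Mapping.keys x \<union> Poly_Mapping.keys y"
  have "Poly_Mapping.keys (x + y) \<subseteq> ?A" by (rule Poly_Mapping.keys_add)
  then show ?thesis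
    by (simp add: hv_bracket_eq_sum[of ?A "Poly_Mapping.keys z"] sum.distrib lookup_add
        distrib_right hv.scale_left_distrib)
qed

lemma hv_bracket_add_right: "hv_bracket z (x + y) = hv_bracket z x + hv_bracket z y"
proof -
  let ?A = "Poly_Mapping.keys x \<union> Poly_Mapping.keys y"
  have "Poly_Mapping.keys (x + y) \<subseteq> ?A" by (rule Poly_Mapping.keys_add)
  then show ?thesis
    by (simp add: hv_bracket_eq_sum[of "Poly_Mapping.keys z" ?A] sum.distrib lookup_add
        distrib_left hv.scale_left_distrib)
qed

lemma hv_bracket_scale_left: "hv_bracket (hv_scale c x) y = hv_scale c (hv_bracket x y)"
proof -
  have "Poly_Mapping.keys (hv_scale c x) \<subseteq> Poly_Mapping.keys x" by (auto simp: in_keys_iff)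
  then show ?thesis
    by (simp add: hv_bracket_eq_sum[of "Poly_Mapping.keys x" "Poly_Mapping.keys y"] hv.scale_sum_right mult.assoc)
qed

lemma hv_bracket_scale_right: "hv_bracket x (hv_scale c y) = hv_scale c (hv_bracket x y)"
proof -
  have "Poly_Mapping.keys (hv_scale c y) \<subseteq> Poly_Mapping.keys y" by (auto simp: in_keys_iff)
  then show ?thesis
    by (simp add: hv_bracket_eq_sum[of "Poly_Mapping.keys x" "Poly_Mapping.keys y"] hv.scale_sum_right mult.left_commute)
qed

lemma hv_sum_single: "(\<Sum>p\<in>Poly_Mapping.keys x. Poly_Mapping.single p (Poly_Mapping.lookup x p)) = x"
  by (rule poly_mapping_eqI) (auto simp: lookup_sum lookup_single when_def in_keys_iff)

lemma hv_induct [case_names zero add single]: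
  assumes "P 0" and "\<And>x y. P x \<Longrightarrow> P y \<Longrightarrow> P (x + y)" and "\<And>p a. P (Poly_Mapping.single p a)"
  shows "P (x :: 'k::field hv)"
proof -
  have "P (\<Sum>p\<in>A. Poly_Mapping.single p (Poly_Mapping.lookup x p))" if "finite A" for A
    using that by induction (auto intro: assms)
  then show ?thesis using hv_sum_single[of x] finite_keys[of x] by metis
qed

lemma hv_bracket_zero [simp]: "hv_bracket 0 x = 0" "hv_bracket x 0 = 0"
  by (simp_all add: hv_bracket_def)

lemma hv_scale_single [simp]: "hv_scale c (Poly_Mapping.single p a) = Poly_Mapping.single p (c * a)"
  by (rule poly_mapping_eqI) (simp add: lookup_single when_def)

lemma hv_bracket_commute: "hv_bracket x y = - hv_bracket y x"
proof (induction x rule: hv_induct)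
  case (single p a)
  show ?case
  proof (induction y rule: hv_induct)
    case (single q b)
    show ?case
      by (cases p; cases q)
        (simp_all add: hv_bracket_single add.commute algebra_simps flip: single_uminus)
  qed (simp_all add: hv_bracket_add_left hv_bracket_add_right)
qed (simp_all add: hv_bracket_add_left hv_bracket_add_right)

lemma hv_bracket_self: "hv_bracket x x = 0"
proof (induction x rule: hv_induct)
  case (add x y)
  then show ?case
    using hv_bracket_commute[of x y] by (simp add: hv_bracket_add_left hv_bracket_add_right)
next
  case (single p a)
  show ?case by (cases p) (simp_all add: hv_bracket_single)
qed simp

lemma hv_jacobi:
  "hv_bracket x (hv_bracket y z) + hv_bracket y (hv_bracket z x) + hv_bracket z (hv_bracket x y) = 0"
proof (induction x rule: hv_induct)
  case (add x x')
  from arg_cong2[OF add, of "(+)"] show ?case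
    by (simp add: hv_bracket_add_left hv_bracket_add_right algebra_simps)
next
  case (single p a)
  show ?case
  proof (induction y rule: hv_induct)
    case (add y y')
    from arg_cong2[OF add, of "(+)"] show ?case
      by (simp add: hv_bracket_add_left hv_bracket_add_right algebra_simps)
  next
    case (single q b)
    show ?case
    proof (induction z rule: hv_induct)
      case (add z z')
      from arg_cong2[OF add, of "(+)"] show ?case
        by (simp add: hv_bracket_add_left hv_bracket_add_right algebra_simps)
    next
      case (single r c)
      show ?case
        by (cases p; cases q; cases r)
          (simp_all add: hv_bracket_single algebra_simps flip: single_add)
    qed simp
  qed simp
qed simp

text \<open>Only closure of \<open>\<Gamma>\<close> under addition is needed for the following.\<close>

lemma lie_algebra_hv:
  assumes \<Gamma>: "\<And>\<alpha> \<beta>. \<alpha> \<in> \<Gamma> \<Longrightarrow> \<beta> \<in> \<Gamma> \<Longrightarrow> \<alpha> + \<beta> \<in> \<Gamma>"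
  shows "lie_algebra hv_scale (hv_carrier \<Gamma>) hv_bracket"
proof unfold_locales
  have "hv_bracket x y \<in> hv_carrier \<Gamma>" if x: "x \<in> hv_carrier \<Gamma>" and y: "y \<in> hv_carrier \<Gamma>" for x y
  proof -
    have "hv_basis_bracket p q \<in> hv_carrier \<Gamma>" if "p \<in> Poly_Mapping.keys x" "q \<in> Poly_Mapping.keys y" for p q
      using that x y \<Gamma> by (cases p; cases q) (auto simp: hv_carrier_def)
    then show ?thesis
      unfolding hv_bracket_def
      by (auto intro!: hv.subspace_sum hv.subspace_scale subspace_hv_carrier)
  qed
  then show "bilinear_product_on hv_scale (hv_carrier \<Gamma>) hv_bracket"
    by (simp add: bilinear_product_on_def hv_bracket_add_left hv_bracket_add_right
        hv_bracket_scale_left hv_bracket_scale_right)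
qed (simp_all add: subspace_hv_carrier hv_bracket_self hv_jacobi)

text \<open>For \<open>\<Gamma> = {0}\<close> the algebra is abelian and carries a nontrivial commutative post-Lie structure
  (\<open>L\<^sub>0\<^sub>,\<^sub>0 \<cdot> L\<^sub>0\<^sub>,\<^sub>0 = H\<^sub>0\<^sub>,\<^sub>0\<close>, all other products of basis vectors being zero), so triviality
  can only hold when \<open>\<Gamma> \<noteq> {0}\<close>.\<close>

lemma hv_zero_nontrivial_post_lie:
  defines "m \<equiv> \<lambda>x y :: 'k::field hv.
    Poly_Mapping.single (H 0 0) (Poly_Mapping.lookup x (L 0 0) * Poly_Mapping.lookup y (L 0 0))"
  shows "commutative_post_lie hv_scale (hv_carrier {0}) hv_bracket m"
    and "\<exists>x\<in>hv_carrier {0}. \<exists>y\<in>hv_carrier {0}. m x y \<noteq> 0"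
proof -
  interpret lie_algebra hv_scale "hv_carrier {0}" "hv_bracket :: 'k hv \<Rightarrow> _"
    by (rule lie_algebra_hv) simp
  have abelian: "hv_bracket x y = 0" if "x \<in> hv_carrier {0}" "y \<in> hv_carrier {0}" for x y :: "'k hv"
  proof -
    have "hv_basis_bracket p q = 0" if "p \<in> Poly_Mapping.keys x" "q \<in> Poly_Mapping.keys y" for p q
      using that \<open>x \<in> _\<close> \<open>y \<in> _\<close> unfolding hv_carrier_def
      by (cases p; cases q) (auto dest!: subsetD)
    then show ?thesis by (simp add: hv_bracket_def)
  qed
  have m_closed: "m x y \<in> hv_carrier {0}" for x y
    by (simp add: m_def hv_carrier_def)
  show "commutative_post_lie hv_scale (hv_carrier {0}) hv_bracket m"
  proof unfold_locales
    show "bilinear_product_on hv_scale (hv_carrier {0}) m"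
      using m_closed unfolding bilinear_product_on_def m_def
      by (auto simp: lookup_add algebra_simps simp flip: single_add)
  qed (simp_all add: abelian m_closed, simp_all add: m_def lookup_single mult.commute)
  have "Poly_Mapping.single (L 0 0) 1 \<in> hv_carrier {0 :: 'k}"
    by (simp add: hv_carrier_def)
  moreover have "m (Poly_Mapping.single (L 0 0) 1) (Poly_Mapping.single (L 0 0) 1) \<noteq> 0"
    by (metis m_def lookup_single_eq lookup_zero mult_1 zero_neq_one)
  ultimately show "\<exists>x\<in>hv_carrier {0}. \<exists>y\<in>hv_carrier {0}. m x y \<noteq> 0" by blast
qed

end

theory Submission
  imports Defs
begin

text \<open>
  Write \<open>I\<close> for the span of the \<open>H\<^sub>\<alpha>\<^sub>,\<^sub>i\<close>, an abelian ideal whose quotient is the loop Witt algebra.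
  Each multiplication operator \<open>mul x\<close> is a derivation, and the symmetry of the product makes
  \<open>mul\<close> a symmetric biderivation. This alone does not force \<open>mul = 0\<close>: the rule sending
  \<open>L\<^sub>\<alpha>\<^sub>,\<^sub>i, L\<^sub>\<beta>\<^sub>,\<^sub>j\<close> to \<open>H\<^sub>\<alpha>\<^sub>+\<^sub>\<beta>\<^sub>,\<^sub>i\<^sub>+\<^sub>j\<close> and annihilating \<open>I\<close> is a nonzero symmetric biderivation. It does
  force two things, and these suffice.

  First, all products lie in \<open>I\<close> (lemma \<open>lcoeff_mul\<close>). The driving force is that
  \<open>e = L\<^sub>0\<^sub>,\<^sub>0\<close> acts diagonally and its eigenvalues recover the \<open>\<Gamma>\<close>-degree, so that the derivation
  rule for \<open>[y, e]\<close> determines the components of \<open>x \<cdot> y\<close> away from the degree of \<open>y\<close> by \<open>x \<cdot> e\<close>.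
  The same rule with \<open>x\<close> and \<open>y\<close> exchanged gives a second formula, and comparing the two kills
  first \<open>e \<cdot> e\<close>, then \<open>e \<cdot> L\<^sub>\<beta>\<^sub>,\<^sub>j\<close>, then all products, modulo \<open>I\<close>.

  Second, \<open>I\<close> multiplies everything to zero (lemma \<open>mul_Hvec\<close>). As \<open>I\<close> is abelian and contains
  all products, \<open>mul x\<close> commutes on \<open>I\<close> with the action of the algebra, hence preserves degrees
  on \<open>I\<close>. If \<open>x = [u, v]\<close> with \<open>u, v\<close> homogeneous of nonzero degrees, the derivation rule expresses
  \<open>h \<cdot> x\<close> through \<open>[h \<cdot> u, v]\<close> and \<open>[u, h \<cdot> v]\<close>, which have the wrong degrees, so \<open>h \<cdot> x = 0\<close>.

  Consequently \<open>[x, y] \<cdot> z = x \<cdot> (y \<cdot> z) - y \<cdot> (x \<cdot> z) = 0\<close>, and the algebra is spanned by brackets.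
\<close>

section \<open>Coefficients of brackets with basis vectors\<close>

abbreviation lcoeff :: "'k::field hv \<Rightarrow> 'k \<Rightarrow> int \<Rightarrow> 'k" where
  "lcoeff x \<gamma> k \<equiv> Poly_Mapping.lookup x (L \<gamma> k)"

abbreviation hcoeff :: "'k::field hv \<Rightarrow> 'k \<Rightarrow> int \<Rightarrow> 'k" where
  "hcoeff x \<gamma> k \<equiv> Poly_Mapping.lookup x (H \<gamma> k)"

abbreviation Lvec :: "'k::field \<Rightarrow> int \<Rightarrow> 'k hv" where
  "Lvec \<alpha> i \<equiv> Poly_Mapping.single (L \<alpha> i) 1"

abbreviation Hvec :: "'k::field \<Rightarrow> int \<Rightarrow> 'k hv" where
  "Hvec \<alpha> i \<equiv> Poly_Mapping.single (H \<alpha> i) 1"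

text \<open>Bracketing with a basis vector shifts the indices and rescales, so each coefficient of the
  result is a multiple of a single coefficient of \<open>x\<close>. This turns the derivation rule into scalar
  equations, even though nothing is known in advance about the support of a product.\<close>

lemma lcoeff_bracket_Lvec:
  "lcoeff (hv_bracket x (Lvec \<beta> j)) \<gamma> k = (\<gamma> - 2 * \<beta>) * lcoeff x (\<gamma> - \<beta>) (k - j)"
proof (induction x rule: hv_induct)
  case (single p a)
  then show ?case
    by (cases p) (auto simp: hv_bracket_single lookup_single when_def algebra_simps)
qed (simp_all add: hv_bracket_add_left lookup_add algebra_simps)

lemma lcoeff_bracket_Hvec: "lcoeff (hv_bracket x (Hvec \<beta> j)) \<gamma> k = 0"
proof (induction x rule: hv_induct)
  case (single p a)
  then show ?case
    by (cases p) (auto simp: hv_bracket_single lookup_single when_def algebra_simps)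
qed (simp_all add: hv_bracket_add_left lookup_add algebra_simps)

lemma hcoeff_bracket_Lvec:
  "hcoeff (hv_bracket x (Lvec \<beta> j)) \<gamma> k = (\<gamma> - \<beta>) * hcoeff x (\<gamma> - \<beta>) (k - j)"
proof (induction x rule: hv_induct)
  case (single p a)
  then show ?case
    by (cases p) (auto simp: hv_bracket_single lookup_single when_def algebra_simps)
qed (simp_all add: hv_bracket_add_left lookup_add algebra_simps)

lemma hcoeff_bracket_Hvec:
  "hcoeff (hv_bracket x (Hvec \<beta> j)) \<gamma> k = - \<beta> * lcoeff x (\<gamma> - \<beta>) (k - j)"
proof (induction x rule: hv_induct)
  case (single p a)
  then show ?case
    by (cases p) (auto simp: hv_bracket_single lookup_single when_def algebra_simps)
qed (simp_all add: hv_bracket_add_left lookup_add algebra_simps)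

lemmas coeff_bracket =
  lcoeff_bracket_Lvec lcoeff_bracket_Hvec hcoeff_bracket_Lvec hcoeff_bracket_Hvec

lemma bracket_Lvec_Lvec:
  "hv_bracket (Lvec \<alpha> i) (Lvec \<beta> j) = hv_scale (\<alpha> - \<beta>) (Lvec (\<alpha> + \<beta>) (i + j))"
  by (simp add: hv_bracket_single)

lemma bracket_Hvec_Lvec:
  "hv_bracket (Hvec \<alpha> i) (Lvec \<beta> j) = hv_scale \<alpha> (Hvec (\<alpha> + \<beta>) (i + j))"
  by (simp add: hv_bracket_single)

text \<open>The hypotheses concern only the terms that make up the given \<open>x\<close>, so that the lemma can also
  exploit the vanishing of some of its coefficients.\<close>

lemma additive_zero_on_basis:
  fixes F :: "'k::field hv \<Rightarrow> 'a::ab_group_add"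
  assumes "x \<in> hv_carrier \<Gamma>"
    and add: "\<And>x y. x \<in> hv_carrier \<Gamma> \<Longrightarrow> y \<in> hv_carrier \<Gamma> \<Longrightarrow> F (x + y) = F x + F y"
    and L: "\<And>\<alpha> i. \<alpha> \<in> \<Gamma> \<Longrightarrow> F (hv_scale (lcoeff x \<alpha> i) (Lvec \<alpha> i)) = 0"
    and H: "\<And>\<alpha> i. \<alpha> \<in> \<Gamma> \<Longrightarrow> F (hv_scale (hcoeff x \<alpha> i) (Hvec \<alpha> i)) = 0"
  shows "F x = 0"
proof -
  let ?s = "\<lambda>A. \<Sum>p\<in>A. Poly_Mapping.single p (Poly_Mapping.lookup x p)"
  have F0: "F 0 = 0"
    using add[of 0 0] by (simp add: hv_carrier_def)
  have carr: "?s A \<in> hv_carrier \<Gamma>" if "A \<subseteq> Poly_Mapping.keys x" for A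
    using that assms(1) by (intro hv.subspace_sum subspace_hv_carrier) (auto simp: hv_carrier_def)
  have "F (?s A) = 0" if "finite A" "A \<subseteq> Poly_Mapping.keys x" for A
    using that
  proof induction
    case (insert p A)
    have "p \<in> Poly_Mapping.keys x" using insert by simp
    then have p: "(\<exists>\<alpha> i. p = L \<alpha> i \<and> \<alpha> \<in> \<Gamma>) \<or> (\<exists>\<alpha> i. p = H \<alpha> i \<and> \<alpha> \<in> \<Gamma>)"
      using assms(1) by (auto simp: hv_carrier_def)
    have "Poly_Mapping.single p (Poly_Mapping.lookup x p) \<in> hv_carrier \<Gamma>"
      using p by (auto simp: hv_carrier_def)
    moreover have "F (Poly_Mapping.single p (Poly_Mapping.lookup x p)) = 0"
      using p L H by auto
    ultimately show ?case
      using insert add carr[of A] by simp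
  qed (simp add: F0)
  from this[of "Poly_Mapping.keys x"] show ?thesis
    by (simp add: hv_sum_single)
qed

section \<open>The derivation rule in coefficients\<close>

locale hv_post_lie = commutative_post_lie hv_scale "hv_carrier \<Gamma>" hv_bracket mul
  for \<Gamma> :: "'k::field_char_0 set" and mul +
  assumes add_closed: "\<alpha> \<in> \<Gamma> \<Longrightarrow> \<beta> \<in> \<Gamma> \<Longrightarrow> \<alpha> + \<beta> \<in> \<Gamma>"
    and uminus_closed: "\<alpha> \<in> \<Gamma> \<Longrightarrow> - \<alpha> \<in> \<Gamma>"
    and zero_closed: "0 \<in> \<Gamma>"
    and nontrivial: "\<Gamma> \<noteq> {0}"
begin

lemma Lvec_carrier [simp]: "\<alpha> \<in> \<Gamma> \<Longrightarrow> Lvec \<alpha> i \<in> hv_carrier \<Gamma>"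
  by (simp add: hv_carrier_def)

lemma Hvec_carrier [simp]: "\<alpha> \<in> \<Gamma> \<Longrightarrow> Hvec \<alpha> i \<in> hv_carrier \<Gamma>"
  by (simp add: hv_carrier_def)

lemma mul_carrier: "x \<in> hv_carrier \<Gamma> \<Longrightarrow> y \<in> hv_carrier \<Gamma> \<Longrightarrow> mul x y \<in> hv_carrier \<Gamma>"
  and mul_add_right: "x \<in> hv_carrier \<Gamma> \<Longrightarrow> y \<in> hv_carrier \<Gamma> \<Longrightarrow> z \<in> hv_carrier \<Gamma> \<Longrightarrow>
    mul x (y + z) = mul x y + mul x z"
  and mul_scale_right: "x \<in> hv_carrier \<Gamma> \<Longrightarrow> y \<in> hv_carrier \<Gamma> \<Longrightarrow>
    mul x (hv_scale c y) = hv_scale c (mul x y)"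
  and mul_add_left: "x \<in> hv_carrier \<Gamma> \<Longrightarrow> y \<in> hv_carrier \<Gamma> \<Longrightarrow> z \<in> hv_carrier \<Gamma> \<Longrightarrow>
    mul (x + y) z = mul x z + mul y z"
  and mul_scale_left: "x \<in> hv_carrier \<Gamma> \<Longrightarrow> y \<in> hv_carrier \<Gamma> \<Longrightarrow>
    mul (hv_scale c x) y = hv_scale c (mul x y)"
  using bilinear_prod unfolding bilinear_product_on_def by blast+

text \<open>With such a splitting, \<open>L\<^sub>\<theta>\<^sub>,\<^sub>i\<close> and \<open>H\<^sub>\<theta>\<^sub>,\<^sub>i\<close> are nonzero multiples of \<open>[L\<^sub>\<mu>\<^sub>,\<^sub>i, L\<^sub>\<nu>\<^sub>,\<^sub>0]\<close> and
  \<open>[H\<^sub>\<mu>\<^sub>,\<^sub>i, L\<^sub>\<nu>\<^sub>,\<^sub>0]\<close>, so the algebra is spanned by brackets of basis vectors of nonzero degree.\<close>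

lemma degree_split:
  assumes "\<theta> \<in> \<Gamma>"
  obtains \<mu> \<nu> where "\<mu> \<in> \<Gamma>" "\<nu> \<in> \<Gamma>" "\<mu> \<noteq> 0" "\<nu> \<noteq> 0" "\<mu> \<noteq> \<nu>" "\<mu> + \<nu> = \<theta>"
proof (cases "\<theta> = 0")
  case True
  obtain \<eta> where \<eta>: "\<eta> \<in> \<Gamma>" "\<eta> \<noteq> 0" using nontrivial zero_closed by auto
  show ?thesis
    using that[of \<eta> "- \<eta>"] \<eta> uminus_closed True by simp
next
  case False
  have "2 * \<theta> \<noteq> - \<theta>"
  proof
    assume "2 * \<theta> = - \<theta>"
    then have "3 * \<theta> = 0" by (simp add: eq_neg_iff_add_eq_0)
    then show False using False by simp
  qed
  then show ?thesis
    using that[of "2 * \<theta>" "- \<theta>"] False add_closed[OF assms assms] uminus_closed[OF assms]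
    by simp
qed

text \<open>The derivation rule for the operator \<open>mul x\<close>, arranged so that every bracket has a basis
  vector on the right, as the coefficient formulas require.\<close>

lemma mul_bracket_Lvec_Lvec:
  assumes "x \<in> hv_carrier \<Gamma>" "\<alpha> \<in> \<Gamma>" "\<beta> \<in> \<Gamma>"
  shows "hv_scale (\<beta> - \<alpha>) (mul x (Lvec (\<beta> + \<alpha>) (j + i))) =
    hv_bracket (mul x (Lvec \<beta> j)) (Lvec \<alpha> i) - hv_bracket (mul x (Lvec \<alpha> i)) (Lvec \<beta> j)"
proof -
  have "mul x (hv_bracket (Lvec \<beta> j) (Lvec \<alpha> i)) =
      hv_bracket (mul x (Lvec \<beta> j)) (Lvec \<alpha> i) + hv_bracket (Lvec \<beta> j) (mul x (Lvec \<alpha> i))"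
    using assms by (intro prod_bracket) simp_all
  then show ?thesis
    unfolding bracket_Lvec_Lvec hv_bracket_commute[of "Lvec \<beta> j"]
    using assms add_closed by (simp add: mul_scale_right del: hv_scale_single)
qed

lemma mul_bracket_Hvec_Lvec:
  assumes "x \<in> hv_carrier \<Gamma>" "\<alpha> \<in> \<Gamma>" "\<beta> \<in> \<Gamma>"
  shows "hv_scale \<beta> (mul x (Hvec (\<beta> + \<alpha>) (j + i))) =
    hv_bracket (mul x (Hvec \<beta> j)) (Lvec \<alpha> i) - hv_bracket (mul x (Lvec \<alpha> i)) (Hvec \<beta> j)"
proof -
  have "mul x (hv_bracket (Hvec \<beta> j) (Lvec \<alpha> i)) =
      hv_bracket (mul x (Hvec \<beta> j)) (Lvec \<alpha> i) + hv_bracket (Hvec \<beta> j) (mul x (Lvec \<alpha> i))"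
    using assms by (intro prod_bracket) simp_all
  then show ?thesis
    unfolding bracket_Hvec_Lvec hv_bracket_commute[of "Hvec \<beta> j"]
    using assms add_closed by (simp add: mul_scale_right del: hv_scale_single)
qed

lemma lcoeff_mul_bracket_LL:
  assumes "x \<in> hv_carrier \<Gamma>" "\<alpha> \<in> \<Gamma>" "\<beta> \<in> \<Gamma>"
  shows "(\<beta> - \<alpha>) * lcoeff (mul x (Lvec (\<beta> + \<alpha>) (j + i))) \<gamma> k =
    (\<gamma> - 2 * \<alpha>) * lcoeff (mul x (Lvec \<beta> j)) (\<gamma> - \<alpha>) (k - i)
    - (\<gamma> - 2 * \<beta>) * lcoeff (mul x (Lvec \<alpha> i)) (\<gamma> - \<beta>) (k - j)"
  using arg_cong[OF mul_bracket_Lvec_Lvec[OF assms, of j i], of "\<lambda>v. lcoeff v \<gamma> k"]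
  by (simp add: lookup_minus coeff_bracket)

lemma lcoeff_mul_bracket_HL:
  assumes "x \<in> hv_carrier \<Gamma>" "\<alpha> \<in> \<Gamma>" "\<beta> \<in> \<Gamma>"
  shows "\<beta> * lcoeff (mul x (Hvec (\<beta> + \<alpha>) (j + i))) \<gamma> k =
    (\<gamma> - 2 * \<alpha>) * lcoeff (mul x (Hvec \<beta> j)) (\<gamma> - \<alpha>) (k - i)"
  using arg_cong[OF mul_bracket_Hvec_Lvec[OF assms, of j i], of "\<lambda>v. lcoeff v \<gamma> k"]
  by (simp add: lookup_minus coeff_bracket)

lemma hcoeff_mul_bracket_LL:
  assumes "x \<in> hv_carrier \<Gamma>" "\<alpha> \<in> \<Gamma>" "\<beta> \<in> \<Gamma>"
  shows "(\<beta> - \<alpha>) * hcoeff (mul x (Lvec (\<beta> + \<alpha>) (j + i))) \<gamma> k =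
    (\<gamma> - \<alpha>) * hcoeff (mul x (Lvec \<beta> j)) (\<gamma> - \<alpha>) (k - i)
    - (\<gamma> - \<beta>) * hcoeff (mul x (Lvec \<alpha> i)) (\<gamma> - \<beta>) (k - j)"
  using arg_cong[OF mul_bracket_Lvec_Lvec[OF assms, of j i], of "\<lambda>v. hcoeff v \<gamma> k"]
  by (simp add: lookup_minus coeff_bracket)

lemma hcoeff_mul_bracket_HL:
  assumes "x \<in> hv_carrier \<Gamma>" "\<alpha> \<in> \<Gamma>" "\<beta> \<in> \<Gamma>"
  shows "\<beta> * hcoeff (mul x (Hvec (\<beta> + \<alpha>) (j + i))) \<gamma> k =
    (\<gamma> - \<alpha>) * hcoeff (mul x (Hvec \<beta> j)) (\<gamma> - \<alpha>) (k - i)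
    + \<beta> * lcoeff (mul x (Lvec \<alpha> i)) (\<gamma> - \<beta>) (k - j)"
  using arg_cong[OF mul_bracket_Hvec_Lvec[OF assms, of j i], of "\<lambda>v. hcoeff v \<gamma> k"]
  by (simp add: lookup_minus coeff_bracket)

section \<open>All products lie in the ideal spanned by the H-vectors\<close>

text \<open>Modulo the ideal, \<open>mul x\<close> restricts to a module homomorphism from the ideal to the loop Witt
  algebra. Bracketing with \<open>L\<^sub>0\<^sub>,\<^sub>0\<close> shows that it preserves degrees, and bracketing \<open>H\<^sub>\<beta>\<^sub>,\<^sub>j\<close>
  with \<open>L\<^sub>-\<^sub>\<beta>\<^sub>,\<^sub>0\<close> leads to the centre, which it must kill because the Witt algebra has no centre.\<close>

lemma lcoeff_mul_Hvec:
  assumes x: "x \<in> hv_carrier \<Gamma>" and \<beta>: "\<beta> \<in> \<Gamma>"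
  shows "lcoeff (mul x (Hvec \<beta> j)) \<gamma> k = 0"
proof -
  have central: "lcoeff (mul x (Hvec 0 j)) \<gamma> k = 0" for j \<gamma> k
  proof -
    obtain \<alpha> where \<alpha>: "\<alpha> \<in> \<Gamma>" "\<gamma> \<noteq> \<alpha>"
      using nontrivial zero_closed by (cases "\<gamma> = 0") auto
    show ?thesis
      using lcoeff_mul_bracket_HL[OF x \<alpha>(1) zero_closed, of j 0 "\<gamma> + \<alpha>" k] \<alpha>(2)
      by simp
  qed
  have 1: "\<beta> * lcoeff (mul x (Hvec \<beta> j)) \<gamma> k = \<gamma> * lcoeff (mul x (Hvec \<beta> j)) \<gamma> k"
    using lcoeff_mul_bracket_HL[OF x zero_closed \<beta>, of j 0 \<gamma> k] by simp
  have 2: "(\<gamma> + \<beta>) * lcoeff (mul x (Hvec \<beta> j)) \<gamma> k = 0"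
    using lcoeff_mul_bracket_HL[OF x uminus_closed[OF \<beta>] \<beta>, of j 0 "\<gamma> - \<beta>" k] central
    by (simp add: add.commute)
  have "2 * \<beta> * lcoeff (mul x (Hvec \<beta> j)) \<gamma> k = 0"
    using 1 2 by algebra
  then show ?thesis using central by (cases "\<beta> = 0") auto
qed

text \<open>The derivation rule for the bracket with the grading element \<open>L\<^sub>0\<^sub>,\<^sub>0\<close>.\<close>

lemma lcoeff_mul_Lvec_eigen:
  assumes "x \<in> hv_carrier \<Gamma>" "\<beta> \<in> \<Gamma>"
  shows "(\<gamma> - \<beta>) * lcoeff (mul x (Lvec \<beta> j)) \<gamma> k =
    (\<gamma> - 2 * \<beta>) * lcoeff (mul x (Lvec 0 0)) (\<gamma> - \<beta>) (k - j)"
  using lcoeff_mul_bracket_LL[OF assms(1) zero_closed assms(2), of j 0 \<gamma> k]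
  by (simp add: algebra_simps)

text \<open>The case \<open>x = L\<^sub>\<alpha>\<^sub>,\<^sub>i\<close>, in which symmetry allows a second application with the
  roles of the factors exchanged.\<close>

lemma lcoeff_mul_Lvec_Lvec_eigen:
  assumes "\<alpha> \<in> \<Gamma>" "\<beta> \<in> \<Gamma>"
  shows "(\<gamma> - \<beta>) * lcoeff (mul (Lvec \<alpha> i) (Lvec \<beta> j)) \<gamma> k =
      (\<gamma> - 2 * \<beta>) * lcoeff (mul (Lvec 0 0) (Lvec \<alpha> i)) (\<gamma> - \<beta>) (k - j)"
    and "(\<gamma> - \<alpha>) * lcoeff (mul (Lvec \<alpha> i) (Lvec \<beta> j)) \<gamma> k =
      (\<gamma> - 2 * \<alpha>) * lcoeff (mul (Lvec 0 0) (Lvec \<beta> j)) (\<gamma> - \<alpha>) (k - i)"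
  using lcoeff_mul_Lvec_eigen[of "Lvec \<alpha> i" \<beta> \<gamma> j k] lcoeff_mul_Lvec_eigen[of "Lvec \<beta> j" \<alpha> \<gamma> i k]
    assms zero_closed prod_commute[of "Lvec \<alpha> i" "Lvec \<beta> j"]
    prod_commute[of "Lvec 0 0" "Lvec \<alpha> i"] prod_commute[of "Lvec 0 0" "Lvec \<beta> j"]
  by simp_all

text \<open>The degree-preserving part of \<open>mul L\<^sub>0\<^sub>,\<^sub>0\<close> satisfies a cross relation between any two distinct
  degrees, obtained by computing the component of \<open>L\<^sub>\<alpha>\<^sub>,\<^sub>i \<cdot> L\<^sub>\<beta>\<^sub>,\<^sub>j\<close> in degree
  \<open>\<alpha> + \<beta>\<close> in both ways.\<close>

lemma lcoeff_mul_zero_cross: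
  assumes \<alpha>: "\<alpha> \<in> \<Gamma>" and \<beta>: "\<beta> \<in> \<Gamma>" and ne: "\<alpha> \<noteq> \<beta>"
  shows "\<beta> * lcoeff (mul (Lvec 0 0) (Lvec \<alpha> i)) \<alpha> (k - j) =
    - \<alpha> * lcoeff (mul (Lvec 0 0) (Lvec \<beta> j)) \<beta> (k - i)"
proof -
  note eigen = lcoeff_mul_Lvec_Lvec_eigen[OF \<alpha> \<beta>, of "\<alpha> + \<beta>" i j k]
  have "(\<alpha> - \<beta>) * (\<beta> * lcoeff (mul (Lvec 0 0) (Lvec \<alpha> i)) \<alpha> (k - j) +
      \<alpha> * lcoeff (mul (Lvec 0 0) (Lvec \<beta> j)) \<beta> (k - i)) = 0"
    using eigen by (simp add: algebra_simps) algebra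
  then show ?thesis using ne by (simp add: eq_neg_iff_add_eq_0)
qed

lemma lcoeff_mul_zero_zero: "lcoeff (mul (Lvec 0 0) (Lvec 0 0)) \<delta> k = 0"
proof (cases "\<delta> = 0")
  case True
  obtain \<alpha> where \<alpha>: "\<alpha> \<in> \<Gamma>" "\<alpha> \<noteq> 0" using nontrivial zero_closed by auto
  show ?thesis
    using lcoeff_mul_zero_cross[OF \<alpha>(1) zero_closed \<alpha>(2), of 0 k 0] \<alpha>(2) True by simp
next
  case False
  show ?thesis
  proof (cases "\<delta> \<in> \<Gamma>")
    case True
    \<comment> \<open>For \<open>L\<^sub>\<delta>\<^sub>,\<^sub>0 \<cdot> L\<^sub>-\<^sub>\<delta>\<^sub>,\<^sub>0\<close> in degree \<open>\<delta>\<close>, the rule for the factor of degree \<open>\<delta>\<close> has left side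
      zero, which kills the degree \<open>0\<close> component of \<open>L\<^sub>0\<^sub>,\<^sub>0 \<cdot> L\<^sub>-\<^sub>\<delta>\<^sub>,\<^sub>0\<close>. The eigenvalue rule
      identifies that component with twice the degree \<open>\<delta>\<close> component of \<open>L\<^sub>0\<^sub>,\<^sub>0 \<cdot> L\<^sub>0\<^sub>,\<^sub>0\<close>.\<close>
    have "\<delta> * lcoeff (mul (Lvec 0 0) (Lvec (- \<delta>) 0)) 0 k = 0"
      using lcoeff_mul_Lvec_Lvec_eigen(2)[OF True uminus_closed[OF True], of \<delta> 0 0 k] False
      by simp
    moreover have "\<delta> * lcoeff (mul (Lvec 0 0) (Lvec (- \<delta>) 0)) 0 k =
        2 * \<delta> * lcoeff (mul (Lvec 0 0) (Lvec 0 0)) \<delta> k"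
      using lcoeff_mul_Lvec_eigen[of "Lvec 0 0" "- \<delta>" 0 0 k] uminus_closed[OF True] zero_closed
      by simp
    ultimately show ?thesis using False by simp
  next
    case False
    have "mul (Lvec 0 0) (Lvec 0 0) \<in> hv_carrier \<Gamma>"
      using mul_carrier zero_closed by simp
    then have "L \<delta> k \<notin> Poly_Mapping.keys (mul (Lvec 0 0) (Lvec 0 0))"
      using False by (auto simp: hv_carrier_def)
    then show ?thesis by (simp add: in_keys_iff)
  qed
qed

lemma lcoeff_mul_zero_Lvec:
  assumes \<beta>: "\<beta> \<in> \<Gamma>"
  shows "lcoeff (mul (Lvec 0 0) (Lvec \<beta> j)) \<gamma> m = 0"
proof (cases "\<gamma> = \<beta>")
  case False
  then show ?thesis
    using lcoeff_mul_Lvec_eigen[of "Lvec 0 0" \<beta> \<gamma> j m] \<beta> zero_closed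
    by (simp add: lcoeff_mul_zero_zero)
next
  case True
  obtain \<eta> where \<eta>: "\<eta> \<in> \<Gamma>" "\<eta> \<noteq> 0" using nontrivial zero_closed by auto
  show ?thesis
  proof (cases "\<beta> = 0")
    case True
    then show ?thesis
      using lcoeff_mul_zero_cross[OF \<eta>(1) zero_closed \<eta>(2), of 0 m j] \<eta>(2) \<open>\<gamma> = \<beta>\<close> by simp
  next
    case False
    \<comment> \<open>The cross relation says that the coefficient in degree \<open>n * \<beta>\<close>, divided by \<open>n\<close>, changes
      sign between any two nonzero degrees; three degrees make it vanish.\<close>
    define s where "s n = lcoeff (mul (Lvec 0 0) (Lvec (n * \<beta>) j)) (n * \<beta>) m" for n
    have mem: "1 * \<beta> \<in> \<Gamma>" "2 * \<beta> \<in> \<Gamma>" "3 * \<beta> \<in> \<Gamma>"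
      using \<beta> add_closed[of \<beta> \<beta>] add_closed[of "2 * \<beta>" \<beta>] by (simp_all add: algebra_simps)
    have cross: "b * s a = - a * s b" if "a * \<beta> \<in> \<Gamma>" "b * \<beta> \<in> \<Gamma>" "a \<noteq> b" for a b
      using lcoeff_mul_zero_cross[OF that(1,2), of j "m + j" j] that(3) False
      by (simp add: s_def) algebra
    have "2 * s 1 = - s 2" "3 * s 1 = - s 3" "3 * s 2 = - 2 * s 3"
      using cross[OF mem(1,2)] cross[OF mem(1,3)] cross[OF mem(2,3)] by simp_all
    then have "12 * s 1 = 0" by algebra
    then show ?thesis using \<open>\<gamma> = \<beta>\<close> by (simp add: s_def)
  qed
qed

text \<open>For \<open>\<alpha> \<noteq> \<beta>\<close> a component of degree \<open>\<gamma>\<close> has \<open>\<gamma> \<noteq> \<alpha>\<close> or \<open>\<gamma> \<noteq> \<beta>\<close>, and the corresponding eigenvalue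
  rule reduces it to products with \<open>L\<^sub>0\<^sub>,\<^sub>0\<close>. For \<open>\<alpha> = \<beta>\<close> the second factor is a bracket of vectors of
  other degrees.\<close>

lemma lcoeff_mul_Lvec_Lvec:
  assumes \<alpha>: "\<alpha> \<in> \<Gamma>" and \<beta>: "\<beta> \<in> \<Gamma>"
  shows "lcoeff (mul (Lvec \<alpha> i) (Lvec \<beta> j)) \<gamma> k = 0"
proof -
  have distinct: "lcoeff (mul (Lvec \<alpha> i) (Lvec \<beta> j)) \<gamma> k = 0"
    if "\<alpha> \<noteq> \<beta>" "\<beta> \<in> \<Gamma>" for \<beta> j \<gamma> k
    using lcoeff_mul_Lvec_Lvec_eigen[OF \<alpha> \<open>\<beta> \<in> \<Gamma>\<close>, of \<gamma> i j k] that
    by (auto simp: lcoeff_mul_zero_Lvec \<alpha>)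
  show ?thesis
  proof (cases "\<alpha> = \<beta>")
    case True
    \<comment> \<open>Both summands differ from \<open>\<beta>\<close> because the other one is nonzero.\<close>
    obtain \<mu> \<nu> where \<mu>\<nu>: "\<mu> \<in> \<Gamma>" "\<nu> \<in> \<Gamma>" "\<mu> \<noteq> 0" "\<nu> \<noteq> 0" "\<mu> \<noteq> \<nu>" "\<mu> + \<nu> = \<beta>"
      using degree_split[OF \<beta>] by metis
    have "\<alpha> \<noteq> \<mu>" "\<alpha> \<noteq> \<nu>" using \<mu>\<nu> True by auto
    then show ?thesis
      using lcoeff_mul_bracket_LL[of "Lvec \<alpha> i" \<nu> \<mu> j 0 \<gamma> k] \<mu>\<nu> \<alpha> by (simp add: distinct)
  qed (use distinct \<beta> in simp)
qed

lemma lcoeff_mul: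
  assumes x: "x \<in> hv_carrier \<Gamma>" and y: "y \<in> hv_carrier \<Gamma>"
  shows "lcoeff (mul x y) \<gamma> k = 0"
  using y
proof (rule additive_zero_on_basis)
  fix \<alpha> i assume \<alpha>: "\<alpha> \<in> \<Gamma>"
  have "lcoeff (mul x (Lvec \<alpha> i)) \<gamma> k = 0"
    using x
  proof (rule additive_zero_on_basis)
    fix \<beta> j assume \<beta>: "\<beta> \<in> \<Gamma>"
    show "lcoeff (mul (hv_scale (lcoeff x \<beta> j) (Lvec \<beta> j)) (Lvec \<alpha> i)) \<gamma> k = 0"
      using \<alpha> \<beta> by (simp add: mul_scale_left lcoeff_mul_Lvec_Lvec del: hv_scale_single)
    have "lcoeff (mul (Hvec \<beta> j) (Lvec \<alpha> i)) \<gamma> k = 0"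
      using lcoeff_mul_Hvec[of "Lvec \<alpha> i" \<beta> j \<gamma> k] prod_commute[of "Hvec \<beta> j" "Lvec \<alpha> i"] \<alpha> \<beta>
      by simp
    then show "lcoeff (mul (hv_scale (hcoeff x \<beta> j) (Hvec \<beta> j)) (Lvec \<alpha> i)) \<gamma> k = 0"
      using \<alpha> \<beta> by (simp add: mul_scale_left del: hv_scale_single)
  qed (simp add: mul_add_left lookup_add \<alpha>)
  then show "lcoeff (mul x (hv_scale (lcoeff y \<alpha> i) (Lvec \<alpha> i))) \<gamma> k = 0"
    using x \<alpha> by (simp add: mul_scale_right del: hv_scale_single)
  show "lcoeff (mul x (hv_scale (hcoeff y \<alpha> i) (Hvec \<alpha> i))) \<gamma> k = 0"
    using x \<alpha> by (simp add: mul_scale_right lcoeff_mul_Hvec del: hv_scale_single)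
qed (simp add: mul_add_right lookup_add x)

section \<open>The ideal annihilates the algebra\<close>

text \<open>On the ideal, \<open>mul x\<close> commutes with the bracket by \<open>L\<^sub>0\<^sub>,\<^sub>0\<close>, hence preserves degrees.\<close>

lemma hcoeff_mul_Hvec_off_degree:
  assumes "x \<in> hv_carrier \<Gamma>" "\<beta> \<in> \<Gamma>" "\<gamma> \<noteq> \<beta>"
  shows "hcoeff (mul x (Hvec \<beta> j)) \<gamma> k = 0"
  using hcoeff_mul_bracket_HL[OF assms(1) zero_closed assms(2), of j 0 \<gamma> k] assms zero_closed
  by (simp add: lcoeff_mul)

text \<open>The operator of \<open>H\<^sub>\<beta>\<^sub>,\<^sub>j\<close> sends every basis vector into degree \<open>\<beta>\<close>. Being a derivation, it
  sends a bracket of vectors of nonzero degrees \<open>\<mu>\<close> and \<open>\<nu>\<close> into the degrees \<open>\<beta> + \<mu>\<close> and \<open>\<beta> + \<nu>\<close>,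
  both different from \<open>\<beta>\<close>.\<close>

lemma hcoeff_mul_Hvec_Lvec:
  assumes \<beta>: "\<beta> \<in> \<Gamma>" and \<theta>: "\<theta> \<in> \<Gamma>"
  shows "hcoeff (mul (Hvec \<beta> j) (Lvec \<theta> n)) \<gamma> k = 0"
proof -
  have off: "hcoeff (mul (Hvec \<beta> j) (Lvec \<theta> n)) \<gamma> k = 0" if "\<theta> \<in> \<Gamma>" "\<gamma> \<noteq> \<beta>" for \<theta> n \<gamma> k
    using hcoeff_mul_Hvec_off_degree[of "Lvec \<theta> n" \<beta> \<gamma> j k] that \<beta>
      prod_commute[of "Hvec \<beta> j" "Lvec \<theta> n"] by simp
  obtain \<mu> \<nu> where \<mu>\<nu>: "\<mu> \<in> \<Gamma>" "\<nu> \<in> \<Gamma>" "\<mu> \<noteq> 0" "\<nu> \<noteq> 0" "\<mu> \<noteq> \<nu>" "\<mu> + \<nu> = \<theta>"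
    using degree_split[OF \<theta>] by metis
  have "hcoeff (mul (Hvec \<beta> j) (Lvec \<theta> n)) \<beta> k = 0"
    using hcoeff_mul_bracket_LL[of "Hvec \<beta> j" \<nu> \<mu> n 0 \<beta> k] \<mu>\<nu> \<beta> by (simp add: off)
  then show ?thesis using off[OF \<theta>] by (cases "\<gamma> = \<beta>") auto
qed

text \<open>The same argument, with \<open>H\<^sub>\<theta>\<^sub>,\<^sub>n\<close> written as a bracket of an H-vector with an L-vector.\<close>

lemma hcoeff_mul_Hvec_Hvec:
  assumes \<beta>: "\<beta> \<in> \<Gamma>" and \<theta>: "\<theta> \<in> \<Gamma>"
  shows "hcoeff (mul (Hvec \<beta> j) (Hvec \<theta> n)) \<gamma> k = 0"
proof -
  have off: "hcoeff (mul (Hvec \<beta> j) (Hvec \<theta> n)) \<gamma> k = 0" if "\<theta> \<in> \<Gamma>" "\<gamma> \<noteq> \<beta>" for \<theta> n \<gamma> k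
    using hcoeff_mul_Hvec_off_degree[of "Hvec \<theta> n" \<beta> \<gamma> j k] that \<beta>
      prod_commute[of "Hvec \<beta> j" "Hvec \<theta> n"] by simp
  obtain \<mu> \<nu> where \<mu>\<nu>: "\<mu> \<in> \<Gamma>" "\<nu> \<in> \<Gamma>" "\<mu> \<noteq> 0" "\<nu> \<noteq> 0" "\<mu> \<noteq> \<nu>" "\<mu> + \<nu> = \<theta>"
    using degree_split[OF \<theta>] by metis
  have "hcoeff (mul (Hvec \<beta> j) (Hvec \<theta> n)) \<beta> k = 0"
    using hcoeff_mul_bracket_HL[of "Hvec \<beta> j" \<nu> \<mu> n 0 \<beta> k] \<mu>\<nu> \<beta> by (simp add: off lcoeff_mul)
  then show ?thesis using off[OF \<theta>] by (cases "\<gamma> = \<beta>") auto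
qed

lemma mul_Hvec:
  assumes \<beta>: "\<beta> \<in> \<Gamma>" and x: "x \<in> hv_carrier \<Gamma>"
  shows "mul (Hvec \<beta> j) x = 0"
  using x
proof (rule additive_zero_on_basis)
  fix \<alpha> i assume \<alpha>: "\<alpha> \<in> \<Gamma>"
  have zero: "z = 0" if "\<And>\<gamma> k. lcoeff z \<gamma> k = 0" "\<And>\<gamma> k. hcoeff z \<gamma> k = 0" for z :: "'k hv"
  proof (rule poly_mapping_eqI)
    fix p show "Poly_Mapping.lookup z p = Poly_Mapping.lookup 0 p"
      using that by (cases p) simp_all
  qed
  have "mul (Hvec \<beta> j) (Lvec \<alpha> i) = 0" "mul (Hvec \<beta> j) (Hvec \<alpha> i) = 0"
    using \<alpha> \<beta> by (auto intro!: zero simp: lcoeff_mul hcoeff_mul_Hvec_Lvec hcoeff_mul_Hvec_Hvec)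
  then show "mul (Hvec \<beta> j) (hv_scale (lcoeff x \<alpha> i) (Lvec \<alpha> i)) = 0"
    "mul (Hvec \<beta> j) (hv_scale (hcoeff x \<alpha> i) (Hvec \<alpha> i)) = 0"
    using \<alpha> \<beta> by (simp_all add: mul_scale_right del: hv_scale_single)
qed (simp add: mul_add_right \<beta>)

lemma mul_mul_zero:
  assumes x: "x \<in> hv_carrier \<Gamma>" and y: "y \<in> hv_carrier \<Gamma>" and z: "z \<in> hv_carrier \<Gamma>"
  shows "mul x (mul y z) = 0"
proof (rule additive_zero_on_basis[OF mul_carrier[OF y z], where F = "mul x"])
  fix \<alpha> i assume \<alpha>: "\<alpha> \<in> \<Gamma>"
  have "mul x 0 = 0"
    using mul_scale_right[OF x x, of 0] by simp
  then show "mul x (hv_scale (lcoeff (mul y z) \<alpha> i) (Lvec \<alpha> i)) = 0"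
    by (simp add: lcoeff_mul[OF y z])
  show "mul x (hv_scale (hcoeff (mul y z) \<alpha> i) (Hvec \<alpha> i)) = 0"
    using x \<alpha> mul_Hvec[OF \<alpha> x] prod_commute[of x "Hvec \<alpha> i"]
    by (simp add: mul_scale_right del: hv_scale_single)
qed (simp add: mul_add_right x)

section \<open>Triviality of the product\<close>

lemma mul_zero:
  assumes x: "x \<in> hv_carrier \<Gamma>" and z: "z \<in> hv_carrier \<Gamma>"
  shows "mul x z = 0"
  using x
proof (rule additive_zero_on_basis)
  fix \<theta> i assume \<theta>: "\<theta> \<in> \<Gamma>"
  obtain \<mu> \<nu> where \<mu>\<nu>: "\<mu> \<in> \<Gamma>" "\<nu> \<in> \<Gamma>" "\<mu> \<noteq> \<nu>" "\<mu> + \<nu> = \<theta>"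
    using degree_split[OF \<theta>] by metis
  have "mul (hv_bracket (Lvec \<mu> i) (Lvec \<nu> 0)) z = 0"
    using \<mu>\<nu> z by (simp add: bracket_prod mul_mul_zero)
  then have "mul (Lvec \<theta> i) z = 0"
    using \<mu>\<nu> \<theta> z
    by (simp add: bracket_Lvec_Lvec mul_scale_left del: hv_scale_single)
  then show "mul (hv_scale (lcoeff x \<theta> i) (Lvec \<theta> i)) z = 0"
    using \<theta> z by (simp add: mul_scale_left del: hv_scale_single)
  show "mul (hv_scale (hcoeff x \<theta> i) (Hvec \<theta> i)) z = 0"
    using \<theta> z by (simp add: mul_scale_left mul_Hvec del: hv_scale_single)
qed (simp add: mul_add_left z)

end

theorem theorem18:
  fixes \<Gamma> :: "'k::{alg_closed_field, field_char_0} set"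
    and mul :: "'k hv \<Rightarrow> 'k hv \<Rightarrow> 'k hv"
  assumes "0 \<in> \<Gamma>"
    and "\<And>\<alpha> \<beta>. \<alpha> \<in> \<Gamma> \<Longrightarrow> \<beta> \<in> \<Gamma> \<Longrightarrow> \<alpha> + \<beta> \<in> \<Gamma>"
    and "\<And>\<alpha>. \<alpha> \<in> \<Gamma> \<Longrightarrow> - \<alpha> \<in> \<Gamma>"
    and "\<Gamma> \<noteq> {0}"
    and "commutative_post_lie hv_scale (hv_carrier \<Gamma>) hv_bracket mul"
  shows "\<forall>x\<in>hv_carrier \<Gamma>. \<forall>y\<in>hv_carrier \<Gamma>. mul x y = 0"
proof -
  interpret commutative_post_lie hv_scale "hv_carrier \<Gamma>" hv_bracket mul by fact
  interpret hv_post_lie \<Gamma> mul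
    using assms(1-4) by unfold_locales auto
  show ?thesis using mul_zero by blast
qed

end
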